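(* Let $\Sigma$ be a connected finite flag complex. For each integer $n\ge 1$ there is a generating set for $\Gamma_n=H_\Sigma\rtimes n\mathbf{Z}$ indexed by the vertices of $\Sigma$, and $\Gamma_n$ cannot be generated by fewer than $|\Sigma^{(0)}|$ elements.
   Context: A flag complex is a simplicial complex in which every set of pairwise adjacent vertices spans a simplex. For a finite flag complex $\Sigma$ with vertices $a_1,\dots,a_N$, the associated right-angled Artin group is $G_\Sigma=\langle e_1,\dots,e_N \mid [e_i,e_j]\text{ for each edge }\{a_i,a_j\}\in\Sigma\rangle$. Let $\pi:G_\Sigma\to\mathbf{Z}$ be the surjection sending every $e_i$ to $1$, let $H_\Sigma=\ker\pi$ (the Bestvina--Brady kernel), and for $n\ge 1$ let $\Gamma_n=\pi^{-1}(n\mathbf{Z})$, so that $\Gamma_n=H_\Sigma\rtimes n\mathbf{Z}$. $\Sigma^{(0)}$ denotes the vertex set of $\Sigma$. *)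

theory Defs
  imports "HOL-Algebra.Algebra"
begin

section \<open>Group presentations\<close>

text \<open>
  A word over the alphabet of generators and their formal inverses is a list of pairs:
  \<open>(a, True)\<close> stands for the generator \<open>a\<close> and \<open>(a, False)\<close> for its inverse.
\<close>

type_synonym 'a word = "('a \<times> bool) list"

definition words :: "'a set \<Rightarrow> 'a word set"
  where "words S = lists (S \<times> UNIV)"

text \<open>
  The congruence on words generated by free cancellation and by deletion of relators.  Its classes
  are the elements of the group with generators \<open>S\<close> and relators \<open>R\<close>.
\<close>

inductive_set pres_rel :: "'a set \<Rightarrow> 'a word set \<Rightarrow> ('a word \<times> 'a word) set"
  for S R where
  refl: "w \<in> words S \<Longrightarrow> (w, w) \<in> pres_rel S R"
| sym: "(u, v) \<in> pres_rel S R \<Longrightarrow> (v, u) \<in> pres_rel S R"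
| trans: "(u, v) \<in> pres_rel S R \<Longrightarrow> (v, w) \<in> pres_rel S R \<Longrightarrow> (u, w) \<in> pres_rel S R"
| cancel: "u \<in> words S \<Longrightarrow> v \<in> words S \<Longrightarrow> a \<in> S
    \<Longrightarrow> (u @ [(a, b), (a, \<not> b)] @ v, u @ v) \<in> pres_rel S R"
| relator: "u \<in> words S \<Longrightarrow> v \<in> words S \<Longrightarrow> r \<in> R \<Longrightarrow> r \<in> words S
    \<Longrightarrow> (u @ r @ v, u @ v) \<in> pres_rel S R"

definition pres_class :: "'a set \<Rightarrow> 'a word set \<Rightarrow> 'a word \<Rightarrow> 'a word set"
  where "pres_class S R w = pres_rel S R `` {w}"

definition presented_group :: "'a set \<Rightarrow> 'a word set \<Rightarrow> 'a word set monoid"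
  where "presented_group S R =
    \<lparr>carrier = words S // pres_rel S R,
     monoid.mult = (\<lambda>A B. \<Union>u\<in>A. \<Union>v\<in>B. pres_class S R (u @ v)),
     one = pres_class S R []\<rparr>"

fun eval_word :: "('b, 'm) monoid_scheme \<Rightarrow> ('a \<Rightarrow> 'b) \<Rightarrow> 'a word \<Rightarrow> 'b" where
  "eval_word K f [] = \<one>\<^bsub>K\<^esub>"
| "eval_word K f ((a, b) # w) =
    (if b then f a else inv\<^bsub>K\<^esub> f a) \<otimes>\<^bsub>K\<^esub> eval_word K f w"

text \<open>
  The homomorphism to \<open>K\<close> that extends \<open>f\<close>.  It is well defined when \<open>f\<close> sends every relator to
  the identity; see \<open>pres_lift_hom\<close> below.
\<close>

definition pres_lift :: "('b, 'm) monoid_scheme \<Rightarrow> ('a \<Rightarrow> 'b) \<Rightarrow> 'a word set \<Rightarrow> 'b"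
  where "pres_lift K f A = the_elem (eval_word K f ` A)"


section \<open>Finite flag complexes\<close>

definition simplicial_complex :: "'a set set \<Rightarrow> bool"
  where "simplicial_complex \<Sigma> \<longleftrightarrow>
    (\<forall>s\<in>\<Sigma>. finite s \<and> s \<noteq> {}) \<and> (\<forall>s\<in>\<Sigma>. \<forall>t\<subseteq>s. t \<noteq> {} \<longrightarrow> t \<in> \<Sigma>)"

definition vertices :: "'a set set \<Rightarrow> 'a set"
  where "vertices \<Sigma> = {a. {a} \<in> \<Sigma>}"

definition adjacent :: "'a set set \<Rightarrow> 'a \<Rightarrow> 'a \<Rightarrow> bool"
  where "adjacent \<Sigma> a b \<longleftrightarrow> a \<noteq> b \<and> {a, b} \<in> \<Sigma>"

definition flag_complex :: "'a set set \<Rightarrow> bool"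
  where "flag_complex \<Sigma> \<longleftrightarrow> simplicial_complex \<Sigma> \<and>
    (\<forall>s. finite s \<and> s \<noteq> {} \<and> s \<subseteq> vertices \<Sigma> \<and>
         (\<forall>a\<in>s. \<forall>b\<in>s. a \<noteq> b \<longrightarrow> adjacent \<Sigma> a b) \<longrightarrow> s \<in> \<Sigma>)"

text \<open>
  A simplicial complex is connected iff any two vertices are joined by an edge path.  The empty
  complex is not excluded.
\<close>

definition connected_complex :: "'a set set \<Rightarrow> bool"
  where "connected_complex \<Sigma> \<longleftrightarrow>
    (\<forall>a\<in>vertices \<Sigma>. \<forall>b\<in>vertices \<Sigma>. (adjacent \<Sigma>)\<^sup>*\<^sup>* a b)"


section \<open>Right-angled Artin groups and Bestvina--Brady kernels\<close>

definition raag_relators :: "'a set set \<Rightarrow> 'a word set"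
  where "raag_relators \<Sigma> =
    {[(a, True), (b, True), (a, False), (b, False)] |a b. adjacent \<Sigma> a b}"

definition raag :: "'a set set \<Rightarrow> 'a word set monoid"
  where "raag \<Sigma> = presented_group (vertices \<Sigma>) (raag_relators \<Sigma>)"

definition raag_gen :: "'a set set \<Rightarrow> 'a \<Rightarrow> 'a word set"
  where "raag_gen \<Sigma> a = pres_class (vertices \<Sigma>) (raag_relators \<Sigma>) [(a, True)]"

definition raag_height :: "'a word set \<Rightarrow> int"
  where "raag_height = pres_lift integer_group (\<lambda>_. 1)"

definition bestvina_brady :: "'a set set \<Rightarrow> 'a word set set"
  where "bestvina_brady \<Sigma> = kernel (raag \<Sigma>) integer_group raag_height"

definition Gamma :: "'a set set \<Rightarrow> nat \<Rightarrow> 'a word set set"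
  where "Gamma \<Sigma> n = {g \<in> carrier (raag \<Sigma>). int n dvd raag_height g}"


section \<open>Basic facts\<close>

lemma words_simps [simp]:
  "[] \<in> words S"
  "x # w \<in> words S \<longleftrightarrow> fst x \<in> S \<and> w \<in> words S"
  "u @ v \<in> words S \<longleftrightarrow> u \<in> words S \<and> v \<in> words S"
  by (cases x, auto simp: words_def)+

lemma pres_rel_words:
  "(u, v) \<in> pres_rel S R \<Longrightarrow> u \<in> words S \<and> v \<in> words S"
  by (induction rule: pres_rel.induct) auto

lemma equiv_pres_rel: "equiv (words S) (pres_rel S R)"
proof (rule equivI)
  show "pres_rel S R \<subseteq> words S \<times> words S" using pres_rel_words by fast
  show "refl_on (words S) (pres_rel S R)"
    by (auto simp: refl_on_def intro: pres_rel.refl)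
  show "sym (pres_rel S R)" by (auto simp: sym_def intro: pres_rel.sym)
  show "trans (pres_rel S R)" by (auto simp: trans_def intro: pres_rel.trans)
qed

lemma pres_rel_append_left:
  "(u, v) \<in> pres_rel S R \<Longrightarrow> w \<in> words S \<Longrightarrow> (w @ u, w @ v) \<in> pres_rel S R"
proof (induction rule: pres_rel.induct)
  case (cancel u v a b)
  then show ?case using pres_rel.cancel[of "w @ u" S v a b R] by simp
next
  case (relator u v r)
  then show ?case using pres_rel.relator[of "w @ u" S v r R] by simp
qed (auto intro: pres_rel.intros)

lemma pres_rel_append_right:
  "(u, v) \<in> pres_rel S R \<Longrightarrow> w \<in> words S \<Longrightarrow> (u @ w, v @ w) \<in> pres_rel S R"
proof (induction rule: pres_rel.induct)
  case (cancel u v a b)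
  then show ?case using pres_rel.cancel[of u S "v @ w" a b R] by simp
next
  case (relator u v r)
  then show ?case using pres_rel.relator[of u S "v @ w" r R] by simp
qed (auto intro: pres_rel.intros)

lemma pres_rel_append:
  assumes "(u, u') \<in> pres_rel S R" "(v, v') \<in> pres_rel S R"
  shows "(u @ v, u' @ v') \<in> pres_rel S R"
  using assms pres_rel_append_left pres_rel_append_right pres_rel_words
  by (metis pres_rel.trans)

lemma pres_class_eq_iff:
  "u \<in> words S \<Longrightarrow> v \<in> words S \<Longrightarrow>
    pres_class S R u = pres_class S R v \<longleftrightarrow> (u, v) \<in> pres_rel S R"
  unfolding pres_class_def by (rule eq_equiv_class_iff[OF equiv_pres_rel])

lemma carrier_presented_group:
  "carrier (presented_group S R) = pres_class S R ` words S"
  by (auto simp: presented_group_def quotient_def pres_class_def)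

lemma one_presented_group:
  "\<one>\<^bsub>presented_group S R\<^esub> = pres_class S R []"
  by (simp add: presented_group_def)

lemma mult_presented_group:
  assumes "u \<in> words S" "v \<in> words S"
  shows "pres_class S R u \<otimes>\<^bsub>presented_group S R\<^esub> pres_class S R v = pres_class S R (u @ v)"
proof -
  have "pres_class S R (u' @ v') = pres_class S R (u @ v)"
    if "u' \<in> pres_class S R u" "v' \<in> pres_class S R v" for u' v'
    using that assms pres_rel_append[of u u' S R v v'] pres_rel_words[of u u'] pres_rel_words[of v v']
    by (subst eq_commute, subst pres_class_eq_iff) (auto simp: pres_class_def)
  moreover from assms have "u \<in> pres_class S R u" "v \<in> pres_class S R v"
    by (auto simp: pres_class_def intro: pres_rel.refl)
  ultimately have "(\<Union>u'\<in>pres_class S R u. \<Union>v'\<in>pres_class S R v. pres_class S R (u' @ v'))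
      = pres_class S R (u @ v)"
    by (intro equalityI subsetI) blast+
  then show ?thesis
    by (simp add: presented_group_def)
qed

lemma pres_rel_inverse_left:
  "w \<in> words S \<Longrightarrow> (rev (map (\<lambda>(a, b). (a, \<not> b)) w) @ w, []) \<in> pres_rel S R"
proof (induction w)
  case Nil
  then show ?case by (auto intro: pres_rel.refl)
next
  case (Cons x w)
  obtain a b where x: "x = (a, b)" by (cases x)
  let ?i = "rev (map (\<lambda>(a, b). (a, \<not> b)) w)"
  have i: "?i \<in> words S" using Cons.prems by (auto simp: words_def)
  have "(?i @ [(a, \<not> b), (a, \<not> \<not> b)] @ w, ?i @ w) \<in> pres_rel S R"
    using Cons.prems i x by (intro pres_rel.cancel) auto
  then show ?case
    using Cons x by (auto intro: pres_rel.trans)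
qed

lemma group_presented_group: "group (presented_group S R)"
proof (rule groupI)
  fix A assume "A \<in> carrier (presented_group S R)"
  then obtain w where w: "w \<in> words S" "A = pres_class S R w"
    by (auto simp: carrier_presented_group)
  let ?i = "rev (map (\<lambda>(a, b). (a, \<not> b)) w)"
  have i: "?i \<in> words S" using w by (auto simp: words_def)
  have "pres_class S R ?i \<otimes>\<^bsub>presented_group S R\<^esub> A = \<one>\<^bsub>presented_group S R\<^esub>"
    using w i pres_rel_inverse_left[of w S R]
    by (simp add: mult_presented_group one_presented_group pres_class_eq_iff)
  then show "\<exists>B\<in>carrier (presented_group S R). B \<otimes>\<^bsub>presented_group S R\<^esub> A = \<one>\<^bsub>presented_group S R\<^esub>"
    using i by (auto simp: carrier_presented_group)
qed (auto simp: carrier_presented_group mult_presented_group one_presented_group)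

context group
begin

lemma eval_word_closed:
  "f \<in> S \<rightarrow> carrier G \<Longrightarrow> w \<in> words S \<Longrightarrow> eval_word G f w \<in> carrier G"
  by (induction w) (auto simp: Pi_iff)

lemma eval_word_append:
  "f \<in> S \<rightarrow> carrier G \<Longrightarrow> u \<in> words S \<Longrightarrow> v \<in> words S \<Longrightarrow>
    eval_word G f (u @ v) = eval_word G f u \<otimes> eval_word G f v"
proof (induction u)
  case (Cons x u)
  then show ?case
    using eval_word_closed[of f S u] eval_word_closed[of f S v]
    by (cases x) (auto simp: m_assoc Pi_iff)
qed (auto simp: eval_word_closed)

lemma eval_word_pres_rel:
  assumes f: "f \<in> S \<rightarrow> carrier G"
    and R: "\<And>r. r \<in> R \<Longrightarrow> r \<in> words S \<Longrightarrow> eval_word G f r = \<one>"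
    and uv: "(u, v) \<in> pres_rel S R"
  shows "eval_word G f u = eval_word G f v"
  using uv
proof (induction rule: pres_rel.induct)
  case (cancel u v a b)
  have fa: "f a \<in> carrier G" using f cancel by auto
  have "eval_word G f [(a, b), (a, \<not> b)] = \<one>" using fa by simp
  then show ?case
    using cancel f eval_word_append[of f S u "[(a, b), (a, \<not> b)] @ v"]
      eval_word_append[of f S "[(a, b), (a, \<not> b)]" v] eval_word_append[of f S u v]
      eval_word_closed[of f S v]
    by (simp del: eval_word.simps)
next
  case (relator u v r)
  then show ?case
    using f R by (simp add: eval_word_append[of f S] eval_word_closed[of f S])
qed auto

lemma pres_lift_class:
  assumes f: "f \<in> S \<rightarrow> carrier G"
    and R: "\<And>r. r \<in> R \<Longrightarrow> r \<in> words S \<Longrightarrow> eval_word G f r = \<one>"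
    and w: "w \<in> words S"
  shows "pres_lift G f (pres_class S R w) = eval_word G f w"
proof -
  have "eval_word G f v = eval_word G f w" if "v \<in> pres_class S R w" for v
    using that eval_word_pres_rel[OF f R, where u = w and v = v] by (auto simp: pres_class_def)
  moreover have "w \<in> pres_class S R w"
    using w by (auto simp: pres_class_def intro: pres_rel.refl)
  ultimately have "eval_word G f ` pres_class S R w = {eval_word G f w}" by blast
  then show ?thesis by (simp add: pres_lift_def)
qed

lemma pres_lift_hom:
  assumes f: "f \<in> S \<rightarrow> carrier G"
    and R: "\<And>r. r \<in> R \<Longrightarrow> r \<in> words S \<Longrightarrow> eval_word G f r = \<one>"
  shows "pres_lift G f \<in> hom (presented_group S R) G"
    and "a \<in> S \<Longrightarrow> pres_lift G f (pres_class S R [(a, True)]) = f a"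
proof -
  show "pres_lift G f \<in> hom (presented_group S R) G"
    using f by (auto simp: hom_def carrier_presented_group mult_presented_group
        pres_lift_class[OF f R] eval_word_closed[OF f] eval_word_append[OF f])
  show "pres_lift G f (pres_class S R [(a, True)]) = f a" if "a \<in> S"
    using f that by (auto simp: pres_lift_class[OF f R] Pi_iff)
qed

end

lemma group_raag: "group (raag \<Sigma>)"
  unfolding raag_def by (rule group_presented_group)

lemma raag_gen_closed: "a \<in> vertices \<Sigma> \<Longrightarrow> raag_gen \<Sigma> a \<in> carrier (raag \<Sigma>)"
  by (auto simp: raag_gen_def raag_def carrier_presented_group)

lemma eval_raag_relator:
  "r \<in> raag_relators \<Sigma> \<Longrightarrow> eval_word integer_group (\<lambda>_. 1) r = \<one>\<^bsub>integer_group\<^esub>"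
  by (auto simp: raag_relators_def)

lemma raag_height_hom: "raag_height \<in> hom (raag \<Sigma>) integer_group"
  unfolding raag_height_def raag_def
  by (rule group.pres_lift_hom) (auto simp: eval_raag_relator)

lemma raag_height_gen: "a \<in> vertices \<Sigma> \<Longrightarrow> raag_height (raag_gen \<Sigma> a) = 1"
  unfolding raag_height_def raag_gen_def
  by (rule group.pres_lift_hom) (auto simp: eval_raag_relator)

lemma group_hom_raag_height: "group_hom (raag \<Sigma>) integer_group raag_height"
  by (simp add: group_hom_def group_hom_axioms_def group_raag raag_height_hom)

lemma subgroup_Gamma: "subgroup (Gamma \<Sigma> n) (raag \<Sigma>)"
proof -
  interpret group_hom "raag \<Sigma>" integer_group raag_height by (rule group_hom_raag_height)
  show ?thesis
    by (rule subgroup.intro) (auto simp: Gamma_def)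
qed

text \<open>
  The internal semidirect product decomposition: the kernel is normal, and the powers of the
  \<open>n\<close>-th power of any generator form a complement of it in \<open>Gamma \<Sigma> n\<close>.
\<close>

lemma Gamma_semidirect:
  assumes a: "a \<in> vertices \<Sigma>" and n: "n \<ge> 1"
  defines "C \<equiv> range (\<lambda>k::int. (raag_gen \<Sigma> a [^]\<^bsub>raag \<Sigma>\<^esub> n) [^]\<^bsub>raag \<Sigma>\<^esub> k)"
  shows "bestvina_brady \<Sigma> \<lhd> raag \<Sigma>"
    and "bestvina_brady \<Sigma> \<inter> C = {\<one>\<^bsub>raag \<Sigma>\<^esub>}"
    and "bestvina_brady \<Sigma> <#>\<^bsub>raag \<Sigma>\<^esub> C = Gamma \<Sigma> n"
    and "raag_height ` C = {k. int n dvd k}"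
proof -
  interpret group_hom "raag \<Sigma>" integer_group raag_height by (rule group_hom_raag_height)
  let ?t = "raag_gen \<Sigma> a [^]\<^bsub>raag \<Sigma>\<^esub> n"
  note ga = raag_gen_closed[OF a]
  have npow: "raag_height (raag_gen \<Sigma> a [^]\<^bsub>raag \<Sigma>\<^esub> m) = int m" for m :: nat
    by (induction m) (auto simp: ga raag_height_gen[OF a])
  have tc: "?t \<in> carrier (raag \<Sigma>)" using ga by simp
  have npow': "raag_height (?t [^]\<^bsub>raag \<Sigma>\<^esub> m) = int n * int m" for m :: nat
    by (induction m) (auto simp: tc npow algebra_simps)
  have ht: "raag_height (?t [^]\<^bsub>raag \<Sigma>\<^esub> k) = int n * k" for k :: int
  proof (cases "k \<ge> 0")
    case True
    then obtain m where "k = int m" using nonneg_int_cases by blast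
    then show ?thesis using npow' by (simp add: int_pow_int)
  next
    case False
    then obtain m where "k = - int m" by (cases k rule: int_cases2) auto
    then show ?thesis using npow' tc by (simp add: G.int_pow_neg int_pow_int)
  qed
  show "bestvina_brady \<Sigma> \<lhd> raag \<Sigma>"
    unfolding bestvina_brady_def by (rule normal_kernel)
  show "raag_height ` C = {k. int n dvd k}"
    by (auto simp: C_def ht image_iff elim!: dvdE)
  show "bestvina_brady \<Sigma> \<inter> C = {\<one>\<^bsub>raag \<Sigma>\<^esub>}"
  proof
    show "bestvina_brady \<Sigma> \<inter> C \<subseteq> {\<one>\<^bsub>raag \<Sigma>\<^esub>}"
      using n by (auto simp: C_def bestvina_brady_def kernel_def ht)
    show "{\<one>\<^bsub>raag \<Sigma>\<^esub>} \<subseteq> bestvina_brady \<Sigma> \<inter> C"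
      by (auto simp: C_def bestvina_brady_def kernel_def intro!: range_eqI[of _ _ 0])
  qed
  show "bestvina_brady \<Sigma> <#>\<^bsub>raag \<Sigma>\<^esub> C = Gamma \<Sigma> n"
  proof
    show "bestvina_brady \<Sigma> <#>\<^bsub>raag \<Sigma>\<^esub> C \<subseteq> Gamma \<Sigma> n"
      using tc by (auto simp: set_mult_def C_def bestvina_brady_def kernel_def Gamma_def ht)
    show "Gamma \<Sigma> n \<subseteq> bestvina_brady \<Sigma> <#>\<^bsub>raag \<Sigma>\<^esub> C"
    proof
      fix g assume "g \<in> Gamma \<Sigma> n"
      then obtain k where g: "g \<in> carrier (raag \<Sigma>)" "raag_height g = int n * k"
        by (auto simp: Gamma_def elim!: dvdE)
      let ?c = "?t [^]\<^bsub>raag \<Sigma>\<^esub> k"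
      have c: "?c \<in> carrier (raag \<Sigma>)" using tc by simp
      have "g \<otimes>\<^bsub>raag \<Sigma>\<^esub> inv\<^bsub>raag \<Sigma>\<^esub> ?c \<in> bestvina_brady \<Sigma>"
        using g c by (simp add: bestvina_brady_def kernel_def ht)
      moreover have "g = g \<otimes>\<^bsub>raag \<Sigma>\<^esub> inv\<^bsub>raag \<Sigma>\<^esub> ?c \<otimes>\<^bsub>raag \<Sigma>\<^esub> ?c"
        using g c by (simp add: G.m_assoc)
      ultimately show "g \<in> bestvina_brady \<Sigma> <#>\<^bsub>raag \<Sigma>\<^esub> C"
        by (auto simp: set_mult_def C_def)
    qed
  qed
qed

end

theory Submission
  imports Defs "HOL-Library.Function_Algebras"
begin

text \<open>
  Root a spanning tree of \<open>\<Sigma>\<close> at a vertex \<open>r\<close> and let \<open>K\<close> be generated by the elements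
  \<open>e\<^sub>a e\<^sub>b\<inverse>\<close>, one for each tree edge from \<open>a\<close> to its parent \<open>b\<close>.  Every generator of the Artin
  group lies in \<open>K e\<^sub>r\<close> and in \<open>e\<^sub>r K\<close>, and \<open>e\<^sub>a e\<^sub>b\<inverse>\<close> commutes with \<open>e\<^sub>a\<close>, so \<open>e\<^sub>r\<close> normalises \<open>K\<close>.
  Hence every element of the Artin group has the form \<open>k e\<^sub>r\<^sup>m\<close> with \<open>k \<in> K\<close>, and its height
  is \<open>m\<close>; so \<open>K\<close> together with \<open>e\<^sub>r\<^sup>n\<close> generates \<open>\<Gamma>\<^sub>n\<close>.

  For the lower bound, the image of \<open>\<Gamma>\<^sub>n\<close> in the rationalised abelianisation contains the vectors
  \<open>n \<delta>\<^sub>a\<close>, so it spans a space of dimension equal to the number of vertices.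
\<close>

section \<open>Subgroups normalised by an element\<close>

context group
begin

lemma inv_mult_cancel_left:
  assumes "x \<in> carrier G" "y \<in> carrier G"
  shows "x \<otimes> (inv x \<otimes> y) = y" "inv x \<otimes> (x \<otimes> y) = y"
  using assms by (simp_all add: m_assoc[symmetric])

text \<open>Conjugation by \<open>c\<close> is a homomorphism, so it suffices to test it on
  \<open>Y\<close>. This gives one inclusion only; normalising takes an application to
  \<open>c\<close> and another to \<open>inv c\<close>.\<close>

lemma generate_conj_closed:
  assumes Y: "Y \<subseteq> carrier G" and c: "c \<in> carrier G"
    and conj: "\<And>x. x \<in> Y \<Longrightarrow> c \<otimes> x \<otimes> inv c \<in> generate G Y"
    and k: "k \<in> generate G Y"
  shows "c \<otimes> k \<otimes> inv c \<in> generate G Y"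
  using k
proof (induction rule: generate.induct)
  case one
  then show ?case using c by (simp add: generate.one)
next
  case (incl h)
  then show ?case by (rule conj)
next
  case (inv h)
  then have h: "h \<in> carrier G" using Y by auto
  have "c \<otimes> inv h \<otimes> inv c = inv (c \<otimes> h \<otimes> inv c)"
    using c h by (simp add: inv_mult_group m_assoc)
  then show ?case
    using generate_m_inv_closed[OF Y conj[OF inv.hyps]] by simp
next
  case (eng h1 h2)
  have h: "h1 \<in> carrier G" "h2 \<in> carrier G"
    using eng.hyps generate_in_carrier[OF Y] by auto
  have "c \<otimes> (h1 \<otimes> h2) \<otimes> inv c = (c \<otimes> h1 \<otimes> inv c) \<otimes> (c \<otimes> h2 \<otimes> inv c)"
    using c h by (simp add: m_assoc inv_mult_cancel_left)
  then show ?case using generate.eng[OF eng.IH] by simp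
qed

text \<open>The products \<open>k \<otimes> r [^] m\<close> are stable under left multiplication by
  \<open>k \<otimes> r\<close> and by its inverse \<open>inv r \<otimes> inv k\<close>: moving
  \<open>r\<close> or \<open>inv r\<close> past an element of \<open>K\<close> only conjugates that
  element.\<close>

lemma generate_subset_subgroup_powers:
  assumes K: "subgroup K G" and r: "r \<in> carrier G"
    and conj: "\<And>k. k \<in> K \<Longrightarrow> r \<otimes> k \<otimes> inv r \<in> K" "\<And>k. k \<in> K \<Longrightarrow> inv r \<otimes> k \<otimes> r \<in> K"
    and E: "\<And>x. x \<in> E \<Longrightarrow> \<exists>k\<in>K. x = k \<otimes> r"
    and g: "g \<in> generate G E"
  shows "\<exists>k\<in>K. \<exists>m::int. g = k \<otimes> r [^] m"
proof -
  interpret K: subgroup K G by fact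
  let ?M = "{k \<otimes> r [^] m |k m::int. k \<in> K}"
  have M: "?M \<subseteq> carrier G" using r K.mem_carrier by auto
  have E': "E \<subseteq> carrier G" using E r K.mem_carrier by blast
  \<comment> \<open>Strengthened for the induction: left multiplication by \<open>g\<close>
    preserves \<open>?M\<close>. The product case is then mere composition, with no need to know
    that \<open>?M\<close> is closed under products. Taking \<open>h = \<one>\<close> recovers the
    claim.\<close>
  have "\<forall>h\<in>?M. g \<otimes> h \<in> ?M"
    using g
  proof (induction rule: generate.induct)
    case one
    show ?case using M by (metis (no_types, lifting) l_one subsetD)
  next
    case (incl x)
    then obtain k where k: "k \<in> K" "x = k \<otimes> r" using E by blast
    show ?case
    proof
      fix h assume "h \<in> ?M"
      then obtain k' and m :: int where h: "k' \<in> K" "h = k' \<otimes> r [^] m" by blast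
      have "r [^] (m + 1) = r \<otimes> r [^] m"
        using r int_pow_mult[of r 1 m] by (simp add: add.commute)
      then have "x \<otimes> h = (k \<otimes> (r \<otimes> k' \<otimes> inv r)) \<otimes> r [^] (m + 1)"
        using k h r K.mem_carrier[OF k(1)] K.mem_carrier[OF h(1)]
        by (simp add: m_assoc inv_mult_cancel_left)
      moreover have "k \<otimes> (r \<otimes> k' \<otimes> inv r) \<in> K" using k(1) conj(1)[OF h(1)] by (rule K.m_closed)
      ultimately show "x \<otimes> h \<in> ?M" by blast
    qed
  next
    case (inv x)
    then obtain k where k: "k \<in> K" "x = k \<otimes> r" using E by blast
    show ?case
    proof
      fix h assume "h \<in> ?M"
      then obtain k' and m :: int where h: "k' \<in> K" "h = k' \<otimes> r [^] m" by blast
      have "r \<otimes> r [^] (m - 1) = r [^] m"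
        using r int_pow_mult[of r 1 "m - 1"] by simp
      then have "inv x \<otimes> h = (inv r \<otimes> (inv k \<otimes> k') \<otimes> r) \<otimes> r [^] (m - 1)"
        using k h r K.mem_carrier[OF k(1)] K.mem_carrier[OF h(1)]
        by (simp add: m_assoc inv_mult_group)
      moreover have "inv r \<otimes> (inv k \<otimes> k') \<otimes> r \<in> K" using k(1) h(1) by (simp add: conj(2))
      ultimately show "inv x \<otimes> h \<in> ?M" by blast
    qed
  next
    case (eng g1 g2)
    then have "g1 \<in> carrier G" "g2 \<in> carrier G" using generate_in_carrier[OF E'] by auto
    then have "g1 \<otimes> g2 \<otimes> h = g1 \<otimes> (g2 \<otimes> h)" if "h \<in> ?M" for h
      using that M by (intro m_assoc) auto
    then show ?case using eng.IH by auto
  qed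
  moreover have "\<one> = \<one> \<otimes> r [^] (0::int)" by simp
  then have "\<one> \<in> ?M" using K.one_closed by blast
  ultimately have "g \<otimes> \<one> \<in> ?M" by blast
  then show ?thesis using generate_in_carrier[OF E' g] by auto
qed

text \<open>A rooted tree is encoded by a parent map \<open>p\<close> and a depth \<open>d\<close>
  that drops along \<open>p\<close>. Commutation along a tree edge lets
  \<open>e a \<otimes> inv e (p a)\<close> stand on either side of \<open>e (p a)\<close>;
  descending to the root, every \<open>e a\<close> lies in both cosets of
  \<open>e r\<close>.\<close>

lemma tree_edges_generate:
  fixes e :: "'v \<Rightarrow> 'a" and d :: "'v \<Rightarrow> nat"
  assumes e: "e \<in> V \<rightarrow> carrier G" and r: "r \<in> V"
    and p: "\<And>a. a \<in> V - {r} \<Longrightarrow> p a \<in> V"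
    and d: "\<And>a. a \<in> V - {r} \<Longrightarrow> d (p a) < d a"
    and comm: "\<And>a. a \<in> V - {r} \<Longrightarrow> e a \<otimes> e (p a) = e (p a) \<otimes> e a"
    and g: "g \<in> generate G (e ` V)"
  defines "Y \<equiv> (\<lambda>a. e a \<otimes> inv e (p a)) ` (V - {r})"
  shows "\<exists>k\<in>generate G Y. \<exists>m::int. g = k \<otimes> e r [^] m"
proof -
  let ?K = "generate G Y"
  have ec: "e a \<in> carrier G" if "a \<in> V" for a using e that by auto
  have Y: "Y \<subseteq> carrier G" using ec p by (auto simp: Y_def)
  have K: "subgroup ?K G" using Y by (rule generate_is_subgroup)
  interpret K: subgroup ?K G by fact
  \<comment> \<open>Induction on depth. Both cosets are needed below: the left factor handles
    conjugation by \<open>e r\<close>, the right factor conjugation by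
    \<open>inv e r\<close>.\<close>
  have left_right: "(\<exists>k\<in>?K. e a = k \<otimes> e r) \<and> (\<exists>k\<in>?K. e a = e r \<otimes> k)" if "a \<in> V" for a
    using that
  proof (induction "d a" arbitrary: a rule: less_induct)
    case less
    show ?case
    proof (cases "a = r")
      case True
      have "e a = \<one> \<otimes> e r" "e a = e r \<otimes> \<one>" using ec r True by auto
      then show ?thesis using K.one_closed by blast
    next
      case False
      then have a: "a \<in> V - {r}" using less.prems by blast
      let ?x = "e a \<otimes> inv e (p a)"
      have x: "?x \<in> ?K" using a by (auto simp: Y_def intro: generate.incl)
      note c = ec[OF less.prems] ec[OF p[OF a]] ec[OF r]
      obtain k l where k: "k \<in> ?K" "e (p a) = k \<otimes> e r" and l: "l \<in> ?K" "e (p a) = e r \<otimes> l"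
        using less.hyps[OF d[OF a] p[OF a]] by blast
      have "e a = ?x \<otimes> e (p a)" using c by (simp add: m_assoc)
      then have 1: "e a = (?x \<otimes> k) \<otimes> e r"
        using k c K.mem_carrier[OF k(1)] K.mem_carrier[OF x] by (simp add: m_assoc)
      have "e (p a) \<otimes> ?x = (e (p a) \<otimes> e a) \<otimes> inv e (p a)" using c by (simp add: m_assoc)
      also have "\<dots> = e a" using c comm[OF a, symmetric] by (simp add: m_assoc)
      finally have "e a = e (p a) \<otimes> ?x" ..
      then have "e a = e r \<otimes> (l \<otimes> ?x)"
        using l c K.mem_carrier[OF l(1)] K.mem_carrier[OF x] by (simp add: m_assoc)
      with 1 show ?thesis using K.m_closed[OF x k(1)] K.m_closed[OF l(1) x] by blast
    qed
  qed
  have rc: "e r \<in> carrier G" using ec r by blast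
  \<comment> \<open>The element \<open>x\<close> commutes with \<open>e a\<close>, and
    \<open>e r\<close> equals both \<open>inv k \<otimes> e a\<close> and
    \<open>e a \<otimes> inv l\<close>. So conjugating \<open>x\<close> by \<open>e r\<close> or by
    \<open>inv e r\<close> amounts to conjugating it by \<open>inv k\<close> or by \<open>l\<close>,
    which lie in \<open>?K\<close>.\<close>
  have conj_gen: "e r \<otimes> x \<otimes> inv e r \<in> ?K \<and> inv e r \<otimes> x \<otimes> inv (inv e r) \<in> ?K" if "x \<in> Y" for x
  proof -
    from that obtain a where a: "a \<in> V - {r}" and x: "x = e a \<otimes> inv e (p a)"
      by (auto simp: Y_def)
    have ac: "e a \<in> carrier G" and pc: "e (p a) \<in> carrier G" and xc: "x \<in> carrier G"
      using a ec p Y that by auto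
    have xK: "x \<in> ?K" using that by (rule generate.incl)
    have "e (p a) \<otimes> x = (e (p a) \<otimes> e a) \<otimes> inv e (p a)" using ac pc by (simp add: x m_assoc)
    also have "\<dots> = e a" using ac pc comm[OF a, symmetric] by (simp add: m_assoc)
    also have "\<dots> = x \<otimes> e (p a)" using ac pc by (simp add: x m_assoc)
    finally have px: "e (p a) \<otimes> x = x \<otimes> e (p a)" .
    have "e a = x \<otimes> e (p a)" using ac pc by (simp add: x m_assoc)
    then have ax: "e a \<otimes> x = x \<otimes> e a" using px xc pc by (simp add: m_assoc)
    obtain k l where k: "k \<in> ?K" "e a = k \<otimes> e r" and l: "l \<in> ?K" "e a = e r \<otimes> l"
      using left_right a by blast
    have kc: "k \<in> carrier G" and lc: "l \<in> carrier G" using k l K.mem_carrier by auto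
    have r1: "e r = inv k \<otimes> e a" using k(2) kc rc by (simp add: inv_mult_cancel_left)
    have r2: "e r = e a \<otimes> inv l" using l(2) lc rc by (simp add: m_assoc)
    have "e r \<otimes> x \<otimes> inv e r = inv k \<otimes> (e a \<otimes> x) \<otimes> (inv e a \<otimes> k)"
      using ac xc kc by (simp add: r1 inv_mult_group m_assoc)
    also have "\<dots> = inv k \<otimes> x \<otimes> k"
      unfolding ax using ac xc kc by (simp add: m_assoc inv_mult_cancel_left)
    finally have 1: "e r \<otimes> x \<otimes> inv e r = inv k \<otimes> x \<otimes> k" .
    have "inv e r \<otimes> x \<otimes> e r = l \<otimes> inv e a \<otimes> (x \<otimes> e a) \<otimes> inv l"
      using ac xc lc by (simp add: r2 inv_mult_group m_assoc)
    also have "\<dots> = l \<otimes> x \<otimes> inv l"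
      unfolding ax[symmetric] using ac xc lc by (simp add: m_assoc inv_mult_cancel_left)
    finally have 2: "inv e r \<otimes> x \<otimes> e r = l \<otimes> x \<otimes> inv l" .
    show ?thesis using 1 2 k(1) l(1) xK rc by simp
  qed
  have "e r \<otimes> k \<otimes> inv e r \<in> ?K" if "k \<in> ?K" for k
    using generate_conj_closed[OF Y rc] conj_gen that by blast
  moreover have "inv e r \<otimes> k \<otimes> e r \<in> ?K" if "k \<in> ?K" for k
    using generate_conj_closed[OF Y inv_closed[OF rc], of k] conj_gen that rc by simp
  ultimately show ?thesis
    using left_right by (intro generate_subset_subgroup_powers[OF K rc _ _ _ g]) auto
qed

end


section \<open>Generators of the Artin group\<close>

lemma generate_raag_gen: "generate (raag \<Sigma>) (raag_gen \<Sigma> ` vertices \<Sigma>) = carrier (raag \<Sigma>)"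
proof
  interpret group "raag \<Sigma>" by (rule group_raag)
  let ?V = "vertices \<Sigma>" and ?R = "raag_relators \<Sigma>"
  have gens: "raag_gen \<Sigma> ` ?V \<subseteq> carrier (raag \<Sigma>)" by (auto intro: raag_gen_closed)
  then show "generate (raag \<Sigma>) (raag_gen \<Sigma> ` ?V) \<subseteq> carrier (raag \<Sigma>)"
    by (rule generate_incl)
  have "pres_class ?V ?R w \<in> generate (raag \<Sigma>) (raag_gen \<Sigma> ` ?V)" if "w \<in> words ?V" for w
    using that
  proof (induction w)
    case Nil
    then show ?case
      using generate.one[of "raag \<Sigma>"] by (simp add: raag_def one_presented_group)
  next
    case (Cons x w)
    obtain a b where x: "x = (a, b)" by (cases x)
    have a: "a \<in> ?V" and w: "w \<in> words ?V" using Cons.prems x by auto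
    have "pres_class ?V ?R [(a, False)] \<otimes>\<^bsub>raag \<Sigma>\<^esub> raag_gen \<Sigma> a = \<one>\<^bsub>raag \<Sigma>\<^esub>"
      using a pres_rel.cancel[of "[]" ?V "[]" a False ?R]
      by (simp add: raag_def raag_gen_def mult_presented_group one_presented_group pres_class_eq_iff)
    then have "pres_class ?V ?R [(a, False)] = inv\<^bsub>raag \<Sigma>\<^esub> raag_gen \<Sigma> a"
      using a raag_gen_closed[OF a]
      by (intro inv_equality[symmetric]) (auto simp: raag_def carrier_presented_group)
    then have "pres_class ?V ?R [x] \<in> generate (raag \<Sigma>) (raag_gen \<Sigma> ` ?V)"
      using a x generate.incl[of "raag_gen \<Sigma> a" "raag_gen \<Sigma> ` ?V" "raag \<Sigma>"]
        generate.inv[of "raag_gen \<Sigma> a" "raag_gen \<Sigma> ` ?V" "raag \<Sigma>"]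
      by (cases b) (simp_all add: raag_gen_def)
    moreover have "pres_class ?V ?R (x # w) = pres_class ?V ?R [x] \<otimes>\<^bsub>raag \<Sigma>\<^esub> pres_class ?V ?R w"
      using a w x by (simp add: raag_def mult_presented_group)
    ultimately show ?case using Cons.IH[OF w] by (simp add: generate.eng)
  qed
  then show "carrier (raag \<Sigma>) \<subseteq> generate (raag \<Sigma>) (raag_gen \<Sigma> ` ?V)"
    by (auto simp: raag_def carrier_presented_group)
qed

text \<open>The commutator relator followed by \<open>b a\<close> reduces in two ways: deleting the
  relator leaves \<open>b a\<close>, while free cancellation leaves \<open>a b\<close>.\<close>

lemma raag_gen_commute:
  assumes ab: "adjacent \<Sigma> a b" and V: "a \<in> vertices \<Sigma>" "b \<in> vertices \<Sigma>"
  shows "raag_gen \<Sigma> a \<otimes>\<^bsub>raag \<Sigma>\<^esub> raag_gen \<Sigma> b = raag_gen \<Sigma> b \<otimes>\<^bsub>raag \<Sigma>\<^esub> raag_gen \<Sigma> a"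
proof -
  let ?V = "vertices \<Sigma>" and ?R = "raag_relators \<Sigma>"
  let ?r = "[(a, True), (b, True), (a, False), (b, False)]"
  have "(?r @ [(b, True), (a, True)], [(b, True), (a, True)]) \<in> pres_rel ?V ?R"
    using V ab pres_rel.relator[of "[]" ?V "[(b, True), (a, True)]" ?r ?R]
    by (auto simp: raag_relators_def)
  moreover have "(?r @ [(b, True), (a, True)], [(a, True), (b, True), (a, False), (a, True)])
      \<in> pres_rel ?V ?R"
    using V pres_rel.cancel[of "[(a, True), (b, True), (a, False)]" ?V "[(a, True)]" b False ?R]
    by simp
  moreover have "([(a, True), (b, True), (a, False), (a, True)], [(a, True), (b, True)])
      \<in> pres_rel ?V ?R"
    using V pres_rel.cancel[of "[(a, True), (b, True)]" ?V "[]" a False ?R] by simp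
  ultimately have "([(a, True), (b, True)], [(b, True), (a, True)]) \<in> pres_rel ?V ?R"
    by (meson pres_rel.sym pres_rel.trans)
  then show ?thesis
    using V by (simp add: raag_def raag_gen_def mult_presented_group pres_class_eq_iff)
qed

section \<open>Spanning trees and the generating set indexed by the vertices\<close>

lemma adjacent_vertices:
  assumes "simplicial_complex \<Sigma>" "adjacent \<Sigma> a b"
  shows "a \<in> vertices \<Sigma>" "b \<in> vertices \<Sigma>"
  using assms unfolding simplicial_complex_def adjacent_def vertices_def
  by (metis empty_not_insert insert_commute insert_subset mem_Collect_eq order_refl subset_insertI)+

text \<open>Take \<open>d\<close> to be the graph distance from \<open>r\<close>. The penultimate
  vertex of a shortest path from \<open>r\<close> to \<open>a\<close> is closer to \<open>r\<close>,
  so it can serve as the parent of \<open>a\<close>.\<close>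

lemma connected_complex_spanning_tree:
  assumes "simplicial_complex \<Sigma>" "connected_complex \<Sigma>" and r: "r \<in> vertices \<Sigma>"
  obtains p and d :: "'a \<Rightarrow> nat" where
    "\<And>a. a \<in> vertices \<Sigma> - {r} \<Longrightarrow> adjacent \<Sigma> (p a) a \<and> d (p a) < d a"
proof -
  define d where "d a = (LEAST m. (adjacent \<Sigma> ^^ m) r a)" for a
  have "\<exists>b. adjacent \<Sigma> b a \<and> d b < d a" if a: "a \<in> vertices \<Sigma> - {r}" for a
  proof -
    have "(adjacent \<Sigma>)\<^sup>*\<^sup>* r a" using assms a by (auto simp: connected_complex_def)
    then have "\<exists>m. (adjacent \<Sigma> ^^ m) r a" by (simp add: rtranclp_power)
    then have path: "(adjacent \<Sigma> ^^ d a) r a" unfolding d_def by (rule LeastI_ex)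
    with a obtain m where m: "d a = Suc m" by (cases "d a") auto
    with path obtain b where b: "(adjacent \<Sigma> ^^ m) r b" "adjacent \<Sigma> b a" by auto
    from b(1) have "d b \<le> m" unfolding d_def by (rule Least_le)
    with b(2) m show ?thesis by auto
  qed
  then show ?thesis using that by metis
qed

text \<open>A spanning tree has one edge for each vertex other than the root, and the root itself is
  left to index the \<open>n\<close>-th power of its generator.\<close>

lemma Gamma_generated_by_vertices:
  assumes \<Sigma>: "simplicial_complex \<Sigma>" "connected_complex \<Sigma>"
  obtains g where "g \<in> vertices \<Sigma> \<rightarrow> Gamma \<Sigma> n"
    and "generate (raag \<Sigma>) (g ` vertices \<Sigma>) = Gamma \<Sigma> n"
proof (cases "vertices \<Sigma> = {}")
  \<comment> \<open>Without vertices there is no root to choose, but the Artin group is then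
    trivial.\<close>
  case True
  interpret group_hom "raag \<Sigma>" integer_group raag_height by (rule group_hom_raag_height)
  have "carrier (raag \<Sigma>) = {\<one>\<^bsub>raag \<Sigma>\<^esub>}"
    using generate_raag_gen[of \<Sigma>] True by (simp add: G.generate_empty)
  then have "Gamma \<Sigma> n = {\<one>\<^bsub>raag \<Sigma>\<^esub>}"
    using subgroup.one_closed[OF subgroup_Gamma] by (auto simp: Gamma_def)
  then show ?thesis using that[of undefined] True by (simp add: G.generate_empty)
next
  case False
  interpret group_hom "raag \<Sigma>" integer_group raag_height by (rule group_hom_raag_height)
  let ?V = "vertices \<Sigma>" and ?e = "raag_gen \<Sigma>"
  obtain r where r: "r \<in> ?V" using False by blast
  obtain p and d :: "'a \<Rightarrow> nat" where
    pd: "\<And>a. a \<in> ?V - {r} \<Longrightarrow> adjacent \<Sigma> (p a) a \<and> d (p a) < d a"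
    using connected_complex_spanning_tree[OF \<Sigma> r] by metis
  have pV: "p a \<in> ?V" if "a \<in> ?V - {r}" for a
    using pd[OF that] adjacent_vertices[OF \<Sigma>(1)] by blast
  let ?x = "\<lambda>a. ?e a \<otimes>\<^bsub>raag \<Sigma>\<^esub> inv\<^bsub>raag \<Sigma>\<^esub> ?e (p a)"
  let ?Y = "?x ` (?V - {r})"
  let ?t = "?e r [^]\<^bsub>raag \<Sigma>\<^esub> int n"
  define g where "g a = (if a = r then ?t else ?x a)" for a
  note rc = raag_gen_closed[OF r]
  have height_pow: "raag_height (?e r [^]\<^bsub>raag \<Sigma>\<^esub> m) = m" for m :: int
    using hom_int_pow[OF rc, of m] by (simp add: raag_height_gen[OF r])
  have x: "?x a \<in> carrier (raag \<Sigma>)" "raag_height (?x a) = 0" if "a \<in> ?V - {r}" for a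
    using that pV[OF that] by (simp_all add: raag_gen_closed raag_height_gen)
  have eV: "?e \<in> ?V \<rightarrow> carrier (raag \<Sigma>)" by (rule Pi_I) (rule raag_gen_closed)
  have comm: "?e a \<otimes>\<^bsub>raag \<Sigma>\<^esub> ?e (p a) = ?e (p a) \<otimes>\<^bsub>raag \<Sigma>\<^esub> ?e a" if "a \<in> ?V - {r}" for a
    using pd[OF that] pV[OF that] that by (intro raag_gen_commute[symmetric]) auto
  have "?t \<in> Gamma \<Sigma> n"
    unfolding Gamma_def mem_Collect_eq height_pow by (intro conjI G.int_pow_closed rc dvd_refl)
  moreover have "?x a \<in> Gamma \<Sigma> n" if "a \<in> ?V - {r}" for a
    unfolding Gamma_def mem_Collect_eq x(2)[OF that] by (intro conjI x(1) that dvd_0_right)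
  ultimately have gV: "g \<in> ?V \<rightarrow> Gamma \<Sigma> n"
    unfolding g_def by (intro Pi_I) (simp split: if_split)
  then have "g ` ?V \<subseteq> Gamma \<Sigma> n" by (simp add: image_subset_iff_funcset)
  note g_sub = this subset_trans[OF this subgroup.subset[OF subgroup_Gamma]]
  have "generate (raag \<Sigma>) (g ` ?V) \<subseteq> Gamma \<Sigma> n"
    using g_sub(1) subgroup_Gamma by (rule G.generate_subgroup_incl)
  moreover have "h \<in> generate (raag \<Sigma>) (g ` ?V)" if h: "h \<in> Gamma \<Sigma> n" for h
  proof -
    note L = G.generate_is_subgroup[OF g_sub(2)]
    have "h \<in> generate (raag \<Sigma>) (?e ` ?V)" using h by (simp add: generate_raag_gen Gamma_def)
    then obtain k and m :: int where k: "k \<in> generate (raag \<Sigma>) ?Y"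
      and hk: "h = k \<otimes>\<^bsub>raag \<Sigma>\<^esub> ?e r [^]\<^bsub>raag \<Sigma>\<^esub> m"
      using G.tree_edges_generate[OF eV r pV _ comm, of d h] pd by blast
    \<comment> \<open>Since \<open>k\<close> has height 0, the exponent \<open>m\<close> is the
      height of \<open>h\<close>. It is therefore a multiple of \<open>n\<close>, and the power of
      \<open>?e r\<close> is a power of \<open>?t\<close>.\<close>
    have "generate (raag \<Sigma>) ?Y \<subseteq> kernel (raag \<Sigma>) integer_group raag_height"
      using x by (intro G.generate_subgroup_incl subgroup_kernel) (auto simp: kernel_def)
    then have "k \<in> carrier (raag \<Sigma>)" "raag_height k = 0" using k by (auto simp: kernel_def)
    then have "raag_height h = m" using rc by (simp add: hk height_pow)
    then obtain j where j: "m = int n * j" using h by (auto simp: Gamma_def elim: dvdE)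
    have "?Y \<subseteq> g ` ?V" by (auto simp: g_def)
    then have kL: "k \<in> generate (raag \<Sigma>) (g ` ?V)" using k G.mono_generate by blast
    have "g r = ?t" by (simp add: g_def)
    then have "?t \<in> generate (raag \<Sigma>) (g ` ?V)" using r by (metis generate.incl imageI)
    then have "?t [^]\<^bsub>raag \<Sigma>\<^esub> j \<in> generate (raag \<Sigma>) (g ` ?V)"
      by (rule G.subgroup_int_pow_closed[OF L])
    moreover have "?t [^]\<^bsub>raag \<Sigma>\<^esub> j = ?e r [^]\<^bsub>raag \<Sigma>\<^esub> m"
      using rc by (simp add: j G.int_pow_pow)
    ultimately show ?thesis using subgroup.m_closed[OF L kL] hk by simp
  qed
  ultimately show ?thesis using that[OF gV] by blast
qed


section \<open>The abelianisation\<close>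

text \<open>The exponent sum of the letter \<open>a\<close>, that is, one coordinate of the
  abelianisation; it is well defined because commutators have exponent sum 0.\<close>

definition raag_exponent :: "'a \<Rightarrow> 'a word set \<Rightarrow> int"
  where "raag_exponent a = pres_lift integer_group (\<lambda>b. if b = a then 1 else 0)"

lemma raag_exponent_hom: "group_hom (raag \<Sigma>) integer_group (raag_exponent a)"
  and raag_exponent_gen:
    "b \<in> vertices \<Sigma> \<Longrightarrow> raag_exponent a (raag_gen \<Sigma> b) = (if b = a then 1 else 0)"
proof -
  have relator: "eval_word integer_group (\<lambda>b. if b = a then 1 else 0) r = \<one>\<^bsub>integer_group\<^esub>"
    if "r \<in> raag_relators \<Sigma>" for r
    using that by (auto simp: raag_relators_def)
  show "group_hom (raag \<Sigma>) integer_group (raag_exponent a)"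
    unfolding group_hom_def group_hom_axioms_def raag_exponent_def
    by (auto simp: group_raag relator raag_def[symmetric]
        intro!: group.pres_lift_hom(1)[where S = "vertices \<Sigma>" and R = "raag_relators \<Sigma>", folded raag_def])
  show "raag_exponent a (raag_gen \<Sigma> b) = (if b = a then 1 else 0)" if "b \<in> vertices \<Sigma>"
    unfolding raag_exponent_def raag_gen_def
    using that relator by (subst group.pres_lift_hom(2)) auto
qed

text \<open>Rational coefficients make exponent vectors elements of a vector space, where an
  independent set in the span of a finite set is no larger than that set.\<close>

interpretation fun_rat: vector_space "\<lambda>(c::rat) (f::'a \<Rightarrow> rat) x. c * f x"
  by unfold_locales (auto simp: algebra_simps)

lemma Gamma_generators_lower_bound:
  fixes \<Sigma> :: "'a set set"
  assumes n: "n \<ge> 1" and S: "finite S" "S \<subseteq> Gamma \<Sigma> n"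
    and gen: "generate (raag \<Sigma>) S = Gamma \<Sigma> n"
  shows "card (vertices \<Sigma>) \<le> card S"
proof -
  interpret h: group_hom "raag \<Sigma>" integer_group raag_height by (rule group_hom_raag_height)
  \<comment> \<open>The coordinate \<open>a\<close> stays a parameter, so that the homomorphism laws
    apply to all coordinates of \<open>\<phi>\<close> at once.\<close>
  interpret group_hom "raag \<Sigma>" integer_group "raag_exponent a" for a :: 'a by (rule raag_exponent_hom)
  define \<phi> where "\<phi> g = (\<lambda>a::'a. rat_of_int (raag_exponent a g))" for g
  let ?V = "vertices \<Sigma>"
  \<comment> \<open>The exponent vector of the \<open>n\<close>-th power of the generator at
    \<open>v\<close>, an element of \<open>Gamma \<Sigma> n\<close>.\<close>
  let ?b = "\<lambda>v a. if v = a then rat_of_nat n else 0"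
  have Sc: "S \<subseteq> carrier (raag \<Sigma>)" using S by (auto simp: Gamma_def)
  have span: "\<phi> g \<in> fun_rat.span (\<phi> ` S)" if "g \<in> generate (raag \<Sigma>) S" for g
    using that
  proof (induction rule: generate.induct)
    case one
    have "\<phi> \<one>\<^bsub>raag \<Sigma>\<^esub> = 0" by (simp add: \<phi>_def fun_eq_iff)
    then show ?case by (metis fun_rat.span_zero)
  next
    case (incl x)
    then show ?case by (simp add: fun_rat.span_base)
  next
    case (inv x)
    then have "\<phi> (inv\<^bsub>raag \<Sigma>\<^esub> x) = - \<phi> x" using Sc by (auto simp: \<phi>_def fun_eq_iff)
    then show ?case using inv by (metis fun_rat.span_base fun_rat.span_neg imageI)
  next
    case (eng x y)
    then have "x \<in> carrier (raag \<Sigma>)" "y \<in> carrier (raag \<Sigma>)"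
      using h.G.generate_in_carrier[OF Sc] by auto
    then have "\<phi> (x \<otimes>\<^bsub>raag \<Sigma>\<^esub> y) = \<phi> x + \<phi> y" by (simp add: \<phi>_def fun_eq_iff)
    then show ?case using eng.IH by (metis fun_rat.span_add)
  qed
  have "?b v \<in> fun_rat.span (\<phi> ` S)" if v: "v \<in> ?V" for v
  proof -
    let ?g = "raag_gen \<Sigma> v [^]\<^bsub>raag \<Sigma>\<^esub> int n"
    note vc = raag_gen_closed[OF v]
    have "?g \<in> Gamma \<Sigma> n"
      using vc h.hom_int_pow[OF vc, of "int n"] by (simp add: Gamma_def raag_height_gen[OF v])
    moreover have "\<phi> ?g = ?b v"
      using hom_int_pow[OF vc, of _ "int n"]
      by (auto simp: \<phi>_def raag_exponent_gen[OF v] fun_eq_iff)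
    ultimately show ?thesis using span gen by metis
  qed
  moreover have "fun_rat.independent (?b ` ?V)"
  proof
    assume "fun_rat.dependent (?b ` ?V)"
    then obtain v where v: "?b v \<in> fun_rat.span (?b ` ?V - {?b v})"
      by (auto simp: fun_rat.dependent_def)
    \<comment> \<open>The remaining vectors all lie in this hyperplane, whereas \<open>?b v\<close>
      has the nonzero value \<open>n\<close> at \<open>v\<close>.\<close>
    have "fun_rat.subspace {f. f v = 0}" by (auto simp: fun_rat.subspace_def)
    then have "fun_rat.span (?b ` ?V - {?b v}) \<subseteq> {f. f v = 0}"
      by (intro fun_rat.span_minimal) auto
    with v show False using n by auto
  qed
  ultimately have "card (?b ` ?V) \<le> card (\<phi> ` S)"
    using fun_rat.independent_span_bound[of "\<phi> ` S" "?b ` ?V"] S(1) by blast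
  moreover have "inj_on ?b ?V"
    using n by (intro inj_onI) (metis not_one_le_zero of_nat_eq_0_iff)
  ultimately show ?thesis
    using card_image card_image_le[OF S(1), of \<phi>] by fastforce
qed

text \<open>The second half counts sets, with \<open>finite S\<close> because \<open>card\<close> of
  an infinite set is 0. Together the halves force the family \<open>g\<close> to be injective on the
  vertices.\<close>

theorem propositionA:
  fixes \<Sigma> :: "'a set set" and n :: nat
  assumes "finite \<Sigma>"
    and "flag_complex \<Sigma>"
    and "connected_complex \<Sigma>"
    and "n \<ge> 1"
  shows "(\<exists>g \<in> vertices \<Sigma> \<rightarrow> Gamma \<Sigma> n.
            generate (raag \<Sigma>) (g ` vertices \<Sigma>) = Gamma \<Sigma> n) \<and>
         \<not> (\<exists>S \<subseteq> Gamma \<Sigma> n. finite S \<and> card S < card (vertices \<Sigma>) \<and>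
              generate (raag \<Sigma>) S = Gamma \<Sigma> n)"
proof
  have "simplicial_complex \<Sigma>" using assms(2) by (simp add: flag_complex_def)
  then show "\<exists>g \<in> vertices \<Sigma> \<rightarrow> Gamma \<Sigma> n.
      generate (raag \<Sigma>) (g ` vertices \<Sigma>) = Gamma \<Sigma> n"
    using Gamma_generated_by_vertices[OF _ assms(3)] by metis
  show "\<not> (\<exists>S \<subseteq> Gamma \<Sigma> n. finite S \<and> card S < card (vertices \<Sigma>) \<and>
      generate (raag \<Sigma>) S = Gamma \<Sigma> n)"
    using Gamma_generators_lower_bound[OF assms(4)] by (meson leD)
qed

end
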